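(* Let $q$ be a prime power and let $t < s$ be positive integers. If there exists a linear $(t,s,q)$-AONT, then there exists a linear $(t,s-1,q)$-AONT.
   Context: For a prime power $q$ and integers $1 \le t \le s$, a linear $(t,s,q)$-all-or-nothing transform (AONT) is an invertible $s\times s$ matrix $M$ over $\mathbb{F}_q$ defining the bijection $\mathbf{y}\mapsto \mathbf{x}=\mathbf{y}M$ of $\mathbb{F}_q^s$ such that, for every set $I$ of $t$ input coordinates and every set $J$ of $t$ output coordinates, knowing the $s-t$ output values $y_j$, $j\notin J$, gives no information about the values $x_i$, $i\in I$. It is a known fact that an invertible $M$ is a linear $(t,s,q)$-AONT if and only if every $t\times t$ submatrix of $M$ is invertible. *)

theory Defs
  imports
    "HOL-Probability.Probability"
    "HOL-Number_Theory.Prime_Powers"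
    "Jordan_Normal_Form.Matrix"
begin

(* Together with nonemptiness, this makes pmf_of_set (carrier_vec s) the uniform distribution. *)
lemma finite_carrier_vec_finite: "finite (carrier_vec s :: 'a :: finite vec set)"
proof (rule finite_subset)
  show "carrier_vec s \<subseteq> vec_of_list ` {xs :: 'a list. set xs \<subseteq> UNIV \<and> length xs = s}"
  proof
    fix v :: "'a vec" assume "v \<in> carrier_vec s"
    then have "v = vec_of_list (list_of_vec v)" "length (list_of_vec v) = s"
      by (auto simp: vec_list)
    then show "v \<in> vec_of_list ` {xs. set xs \<subseteq> UNIV \<and> length xs = s}" by blast
  qed
  show "finite (vec_of_list ` {xs :: 'a list. set xs \<subseteq> UNIV \<and> length xs = s})"
    by (intro finite_imageI finite_lists_length_eq) auto
qed

(* The input is drawn uniformly at random. "No information" means that conditioning on any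
   possible observation of the outputs outside J leaves the distribution of the inputs in I
   unchanged. The observation is the one produced by an actual input z, so the conditioning
   event always has positive probability. *)
definition no_information ::
  "nat \<Rightarrow> ('a :: finite vec \<Rightarrow> 'a vec) \<Rightarrow> nat set \<Rightarrow> nat set \<Rightarrow> bool" where
  "no_information s \<phi> I J \<longleftrightarrow>
     (\<forall>a \<in> carrier_vec s. \<forall>z \<in> carrier_vec s.
        \<P>(x in measure_pmf (pmf_of_set (carrier_vec s)).
             (\<forall>i \<in> I. x $ i = a $ i) \<bar> (\<forall>j \<in> {..<s} - J. \<phi> x $ j = \<phi> z $ j))
        = \<P>(x in measure_pmf (pmf_of_set (carrier_vec s)). \<forall>i \<in> I. x $ i = a $ i))"

definition aont :: "nat \<Rightarrow> nat \<Rightarrow> ('a :: finite vec \<Rightarrow> 'a vec) \<Rightarrow> bool" where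
  "aont t s \<phi> \<longleftrightarrow>
     1 \<le> t \<and> t \<le> s \<and> bij_betw \<phi> (carrier_vec s) (carrier_vec s) \<and>
     (\<forall>I J. I \<subseteq> {..<s} \<and> card I = t \<and> J \<subseteq> {..<s} \<and> card J = t
        \<longrightarrow> no_information s \<phi> I J)"

(* The product of the row vector y with M. *)
definition vec_mult_mat :: "'a :: comm_semiring_0 vec \<Rightarrow> 'a mat \<Rightarrow> 'a vec" where
  "vec_mult_mat y M = transpose_mat M *\<^sub>v y"

(* M describes the map from outputs y to inputs x = y M; the transform itself is the inverse. *)
definition linear_aont :: "nat \<Rightarrow> nat \<Rightarrow> 'a :: {finite, field} mat \<Rightarrow> bool" where
  "linear_aont t s M \<longleftrightarrow>
     M \<in> carrier_mat s s \<and> invertible_mat M \<and>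
     aont t s (inv_into (carrier_vec s) (\<lambda>y. vec_mult_mat y M))"

end

(* An observation of the outputs outside J leaves q^t possible inputs, so it says nothing about the
   inputs in I exactly if each of the q^t values of those inputs is taken once. As the system is
   linear, this is injectivity on the vectors supported on J, i.e. invertibility of a t x t
   submatrix. This property passes to the matrix obtained by deleting a row and a column, and some
   such matrix is invertible because a Laplace expansion of det M has a nonzero cofactor. *)
theory Submission
  imports Defs "Jordan_Normal_Form.Determinant"
begin

unbundle no vec_syntax

(* Invertibility of the submatrix of M with rows J and columns I, stated for row vectors
   supported on J. *)
definition block_injective :: "'a :: comm_ring_1 mat \<Rightarrow> nat \<Rightarrow> nat set \<Rightarrow> nat set \<Rightarrow> bool" where
  "block_injective M s I J \<longleftrightarrow>
     (\<forall>y \<in> carrier_vec s. (\<forall>j \<in> {..<s} - J. y $ j = 0) \<and> (\<forall>i \<in> I. vec_mult_mat y M $ i = 0)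
        \<longrightarrow> y = 0\<^sub>v s)"

section \<open>Vectors with prescribed coordinates, and multiplication by M\<close>

text \<open>The coordinates in J are free and all others are copied from z, so such vectors
  correspond to arbitrary functions on J. The count serves for the whole space, for the inputs with
  given values on I, and for the vectors consistent with an observation.\<close>

lemma card_vec_agree:
  fixes z :: "'a :: finite vec"
  assumes J: "J \<subseteq> {..<s}" and z: "z \<in> carrier_vec s"
  shows "card {v \<in> carrier_vec s. \<forall>j \<in> {..<s} - J. v $ j = z $ j} = CARD('a) ^ card J"
proof -
  let ?A = "{v \<in> carrier_vec s. \<forall>j \<in> {..<s} - J. v $ j = z $ j}"
  have "bij_betw (\<lambda>v. restrict (\<lambda>j. v $ j) J) ?A (PiE J (\<lambda>_. UNIV))"
  proof (rule bij_betw_byWitness)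
    let ?g = "\<lambda>f. vec s (\<lambda>i. if i \<in> J then f i else z $ i)"
    show "\<forall>v\<in>?A. ?g (restrict (\<lambda>j. v $ j) J) = v"
      by (auto intro!: eq_vecI)
    show "\<forall>f\<in>PiE J (\<lambda>_. UNIV). restrict (\<lambda>j. ?g f $ j) J = f"
    proof (intro ballI ext)
      fix f :: "nat \<Rightarrow> 'a" and j assume f: "f \<in> PiE J (\<lambda>_. UNIV)"
      show "restrict (\<lambda>j. ?g f $ j) J j = f j"
        using J PiE_arb[OF f, of j] by (cases "j \<in> J") auto
    qed
    show "(\<lambda>v. restrict (\<lambda>j. v $ j) J) ` ?A \<subseteq> PiE J (\<lambda>_. UNIV)" by auto
    show "?g ` PiE J (\<lambda>_. UNIV) \<subseteq> ?A" by auto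
  qed
  then have "card ?A = card (PiE J (\<lambda>_. UNIV :: 'a set))" by (rule bij_betw_same_card)
  also have "\<dots> = CARD('a) ^ card J"
    using finite_subset[OF J] by (simp add: card_PiE)
  finally show ?thesis .
qed

lemma vec_mult_mat_carrier:
  "M \<in> carrier_mat n m \<Longrightarrow> vec_mult_mat y M \<in> carrier_vec m"
  unfolding vec_mult_mat_def by (intro carrier_vecI) simp

lemma vec_mult_mat_index:
  assumes "M \<in> carrier_mat n m" "y \<in> carrier_vec n" "i < m"
  shows "vec_mult_mat y M $ i = (\<Sum>j<n. M $$ (j, i) * y $ j)"
  using assms unfolding vec_mult_mat_def
  by (auto simp: scalar_prod_def lessThan_atLeast0 intro!: sum.cong)

lemma vec_mult_mat_minus:
  fixes M :: "'a :: comm_ring_1 mat"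
  assumes "M \<in> carrier_mat n m" "y \<in> carrier_vec n" "z \<in> carrier_vec n"
  shows "vec_mult_mat (y - z) M = vec_mult_mat y M - vec_mult_mat z M"
  unfolding vec_mult_mat_def using assms by (intro mult_minus_distrib_mat_vec) auto

lemma vec_mult_mat_zero:
  "M \<in> carrier_mat n m \<Longrightarrow> vec_mult_mat (0\<^sub>v n) (M :: 'a :: comm_ring_1 mat) = 0\<^sub>v m"
  unfolding vec_mult_mat_def by (intro eq_vecI) (auto simp: scalar_prod_def)

text \<open>Multiplying by the inverse matrix undoes the map, which makes it injective; finiteness
  of the space then gives surjectivity.\<close>

lemma bij_vec_mult_mat:
  fixes M :: "'a :: {finite, comm_ring_1} mat"
  assumes M: "M \<in> carrier_mat s s" and inv: "invertible_mat M"
  shows "bij_betw (\<lambda>y. vec_mult_mat y M) (carrier_vec s) (carrier_vec s)"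
proof -
  obtain B where B: "M * B = 1\<^sub>m s" "B * M = 1\<^sub>m (dim_row B)"
    using inv M unfolding invertible_mat_def inverts_mat_def by auto
  \<comment> \<open>\<open>invertible_mat\<close> does not state the dimensions of B. Comparing
    column counts in the two identities yields them: the first gives the columns of B, the second
    its rows.\<close>
  have dB: "B \<in> carrier_mat s s"
    using arg_cong[OF B(1), of dim_col] arg_cong[OF B(2), of dim_col] M by auto
  have "vec_mult_mat (vec_mult_mat y M) B = y" if "y \<in> carrier_vec s" for y
  proof -
    have "vec_mult_mat (vec_mult_mat y M) B = (B\<^sup>T * M\<^sup>T) *\<^sub>v y"
      unfolding vec_mult_mat_def using M dB that by (intro assoc_mult_mat_vec[symmetric]) auto
    also have "B\<^sup>T * M\<^sup>T = (M * B)\<^sup>T" using M dB by (intro transpose_mult[symmetric])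
    finally show ?thesis using that B by simp
  qed
  then have inj: "inj_on (\<lambda>y. vec_mult_mat y M) (carrier_vec s)"
    by (rule inj_on_inverseI)
  have "(\<lambda>y. vec_mult_mat y M) ` carrier_vec s \<subseteq> carrier_vec s"
    using vec_mult_mat_carrier[OF M] by auto
  with inj show ?thesis
    unfolding bij_betw_def using endo_inj_surj[OF finite_carrier_vec_finite] by blast
qed

section \<open>From probabilities to linear algebra\<close>

text \<open>For a uniform input, probabilities are ratios of counts. Substituting x = y M turns
  counts of inputs into counts of outputs, so that the inverse map disappears and both events become
  explicit conditions on y.\<close>

lemma no_information_iff_card:
  fixes M :: "'a :: {finite, comm_ring_1} mat"
  assumes M: "M \<in> carrier_mat s s" and inv: "invertible_mat M"
    and I: "I \<subseteq> {..<s}" "card I = t" and J: "J \<subseteq> {..<s}" "card J = t"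
  shows "no_information s (inv_into (carrier_vec s) (\<lambda>y. vec_mult_mat y M)) I J \<longleftrightarrow>
    (\<forall>a \<in> carrier_vec s. \<forall>z \<in> carrier_vec s.
       card {y \<in> carrier_vec s. (\<forall>j \<in> {..<s} - J. y $ j = z $ j) \<and>
         (\<forall>i \<in> I. vec_mult_mat y M $ i = a $ i)} = 1)"
  (is "_ \<longleftrightarrow> (\<forall>a\<in>?C. \<forall>z\<in>?C. card (?N a z) = 1)")
proof -
  let ?\<psi> = "\<lambda>y. vec_mult_mat y M"
  let ?\<phi> = "inv_into ?C ?\<psi>"
  let ?q = "CARD('a)"
  note bij = bij_vec_mult_mat[OF M inv]
  note bij' = bij_betw_inv_into[OF bij]
  have t: "t \<le> s" using card_mono[OF _ J(1)] J(2) by simp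
  have q: "?q > 0" by simp
  have finC: "finite ?C" by (rule finite_carrier_vec_finite)
  have neC: "?C \<noteq> {}" using zero_carrier_vec by blast
  have cardC: "card ?C = ?q ^ s"
    using card_vec_agree[of "{..<s}" s "0\<^sub>v s :: 'a vec"] by simp
  have inj: "?\<phi> (?\<psi> y) = y" if "y \<in> ?C" for y
    using bij that by (intro inv_into_f_f) (auto simp: bij_betw_def)
  have image: "{x \<in> ?C. P x (?\<phi> x)} = ?\<psi> ` {y \<in> ?C. P (?\<psi> y) y}" for P
  proof (intro Set.set_eqI iffI)
    fix x assume x: "x \<in> {x \<in> ?C. P x (?\<phi> x)}"
    then obtain y where "y \<in> ?C" "x = ?\<psi> y" using bij unfolding bij_betw_def by blast
    then show "x \<in> ?\<psi> ` {y \<in> ?C. P (?\<psi> y) y}" using x inj by auto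
  next
    fix x assume "x \<in> ?\<psi> ` {y \<in> ?C. P (?\<psi> y) y}"
    then show "x \<in> {x \<in> ?C. P x (?\<phi> x)}" using inj vec_mult_mat_carrier[OF M] by auto
  qed
  have count: "card {x \<in> ?C. P x (?\<phi> x)} = card {y \<in> ?C. P (?\<psi> y) y}" for P
    unfolding image using bij
    by (intro card_image) (auto simp: bij_betw_def intro: inj_on_subset)
  have prior: "card {x \<in> ?C. \<forall>i \<in> I. x $ i = a $ i} = ?q ^ (s - t)" if "a \<in> ?C" for a :: "'a vec"
  proof -
    \<comment> \<open>\<open>card_vec_agree\<close> prescribes the values outside its set, so it is
      applied to the complement of I.\<close>
    have "{..<s} - ({..<s} - I) = I" using I by auto
    moreover have "card ({..<s} - I) = s - t"
      using I finite_subset[OF I(1)] by (simp add: card_Diff_subset)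
    ultimately show ?thesis using card_vec_agree[of "{..<s} - I" s a] that by simp
  qed
  have key: "\<P>(x in measure_pmf (pmf_of_set ?C).
          (\<forall>i \<in> I. x $ i = a $ i) \<bar> (\<forall>j \<in> {..<s} - J. ?\<phi> x $ j = ?\<phi> w $ j))
        = \<P>(x in measure_pmf (pmf_of_set ?C). \<forall>i \<in> I. x $ i = a $ i)
     \<longleftrightarrow> card (?N a (?\<phi> w)) = 1" if a: "a \<in> ?C" and w: "w \<in> ?C" for a w
  proof -
    have \<phi>w: "?\<phi> w \<in> ?C" using bij' w by (auto simp: bij_betw_def)
    have pr: "measure (measure_pmf (pmf_of_set ?C)) {x. P x} = real (card {x \<in> ?C. P x}) / ?q ^ s" for P
      by (simp add: measure_pmf_of_set[OF neC finC] cardC Int_def)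
    have joint: "card {x \<in> ?C. (\<forall>i \<in> I. x $ i = a $ i) \<and> (\<forall>j \<in> {..<s} - J. ?\<phi> x $ j = ?\<phi> w $ j)}
        = card (?N a (?\<phi> w))"
      by (subst count) (auto intro!: arg_cong[where f = card])
    have obs: "card {x \<in> ?C. \<forall>j \<in> {..<s} - J. ?\<phi> x $ j = ?\<phi> w $ j} = ?q ^ t"
      by (subst count) (use card_vec_agree[OF J(1) \<phi>w] J(2) in simp)
    \<comment> \<open>If N outputs fit both the observation and the input values, the conditional
      probability is N / q^t, while the unconditional one is q^(s-t) / q^s = 1 / q^t. They agree
      exactly when N = 1.\<close>
    have "real ?q ^ s = ?q ^ (s - t) * ?q ^ t"
      using t by (simp flip: power_add)
    then show ?thesis
      using q unfolding cond_prob_def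
      by (simp add: pr joint obs prior[OF a] field_simps)
  qed
  have "no_information s ?\<phi> I J \<longleftrightarrow> (\<forall>a \<in> ?C. \<forall>w \<in> ?C. card (?N a (?\<phi> w)) = 1)"
    unfolding no_information_def using key by simp
  \<comment> \<open>Since \<open>?\<phi>\<close> is onto, the observations arising from inputs w are
    those of all vectors z.\<close>
  also have "\<dots> \<longleftrightarrow> (\<forall>a \<in> ?C. \<forall>z \<in> ?\<phi> ` ?C. card (?N a z) = 1)" by simp
  also have "?\<phi> ` ?C = ?C" using bij' by (simp add: bij_betw_def)
  finally show ?thesis .
qed

text \<open>Unique solvability of the inhomogeneous system for all right-hand sides is equivalent to
  triviality of its kernel, because the system is square: \<open>card I = card J\<close>.\<close>

lemma no_information_iff_block_injective:
  fixes M :: "'a :: {finite, comm_ring_1} mat"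
  assumes M: "M \<in> carrier_mat s s" and inv: "invertible_mat M"
    and I: "I \<subseteq> {..<s}" "card I = t" and J: "J \<subseteq> {..<s}" "card J = t"
  shows "no_information s (inv_into (carrier_vec s) (\<lambda>y. vec_mult_mat y M)) I J \<longleftrightarrow>
    block_injective M s I J"
  unfolding no_information_iff_card[OF assms]
proof (intro iffI ballI)
  let ?N = "\<lambda>a z. {y \<in> carrier_vec s. (\<forall>j \<in> {..<s} - J. y $ j = z $ j) \<and>
         (\<forall>i \<in> I. vec_mult_mat y M $ i = a $ i)}"
  assume one: "\<forall>a \<in> carrier_vec s. \<forall>z \<in> carrier_vec s. card (?N a z) = 1"
  show "block_injective M s I J"
    unfolding block_injective_def
  proof (intro ballI impI)
    fix y assume y: "y \<in> carrier_vec s"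
      "(\<forall>j \<in> {..<s} - J. y $ j = 0) \<and> (\<forall>i \<in> I. vec_mult_mat y M $ i = 0)"
    \<comment> \<open>For a = z = 0 the solutions are exactly the kernel vectors. Both y and the
      zero vector are among them, so uniqueness identifies the two.\<close>
    have "card (?N (0\<^sub>v s) (0\<^sub>v s)) = 1" using one zero_carrier_vec by blast
    then obtain u where u: "?N (0\<^sub>v s) (0\<^sub>v s) = {u}" by (rule card_1_singletonE)
    have "y \<in> ?N (0\<^sub>v s) (0\<^sub>v s)" using y I by auto
    moreover have "0\<^sub>v s \<in> ?N (0\<^sub>v s) (0\<^sub>v s)" using vec_mult_mat_zero[OF M] by simp
    ultimately show "y = 0\<^sub>v s" unfolding u by simp
  qed
next
  fix a z :: "'a vec"
  assume ker: "block_injective M s I J" and a: "a \<in> carrier_vec s" and z: "z \<in> carrier_vec s"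
  let ?A = "{y \<in> carrier_vec s. \<forall>j \<in> {..<s} - J. y $ j = z $ j}"
  let ?P = "PiE I (\<lambda>_. UNIV :: 'a set)"
  let ?f = "\<lambda>y. restrict (\<lambda>i. vec_mult_mat y M $ i) I"
  have finI: "finite I" using finite_subset[OF I(1)] by simp
  \<comment> \<open>Two vectors of \<open>?A\<close> agree outside J, so their difference is
    supported on J; equal images put it in the kernel.\<close>
  have inj: "inj_on ?f ?A"
  proof (rule inj_onI)
    fix y y' assume y: "y \<in> ?A" and y': "y' \<in> ?A" and eq: "?f y = ?f y'"
    have "vec_mult_mat (y - y') M $ i = 0" if "i \<in> I" for i
    proof -
      have "vec_mult_mat y M $ i = vec_mult_mat y' M $ i"
        using fun_cong[OF eq, of i] that by simp
      moreover have "i < s" using that I by auto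
      ultimately show ?thesis
        using y y' vec_mult_mat_carrier[OF M, of y] vec_mult_mat_carrier[OF M, of y']
        by (simp add: vec_mult_mat_minus[OF M])
    qed
    then have "y - y' = 0\<^sub>v s"
      using ker y y' unfolding block_injective_def by auto
    show "y = y'"
    proof (rule eq_vecI)
      show "dim_vec y = dim_vec y'" using y y' by auto
      fix i assume "i < dim_vec y'"
      then show "y $ i = y' $ i"
        using arg_cong[OF \<open>y - y' = 0\<^sub>v s\<close>, of "\<lambda>v. v $ i"] y y' by auto
    qed
  qed
  \<comment> \<open>Domain and target both have q^t elements, so injectivity forces surjectivity,
    which provides the solution u for a.\<close>
  have "?f ` ?A = ?P"
  proof (rule card_subset_eq)
    show "finite ?P" using finI by (intro finite_PiE) auto
    show "card (?f ` ?A) = card ?P"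
      using card_vec_agree[OF J(1) z] I J finI by (simp add: card_image[OF inj] card_PiE)
  qed auto
  moreover have "restrict (\<lambda>i. a $ i) I \<in> ?P" by auto
  ultimately obtain u where u: "u \<in> ?A" "?f u = restrict (\<lambda>i. a $ i) I"
    by (metis (no_types, lifting) imageE)
  have "{y \<in> carrier_vec s. (\<forall>j \<in> {..<s} - J. y $ j = z $ j) \<and>
         (\<forall>i \<in> I. vec_mult_mat y M $ i = a $ i)} = {y \<in> ?A. ?f y = ?f u}"
    unfolding u(2) by (auto simp: restrict_def fun_eq_iff split: if_splits)
  also have "\<dots> = {u}" using inj u(1) unfolding inj_on_def by blast
  finally show "card {y \<in> carrier_vec s. (\<forall>j \<in> {..<s} - J. y $ j = z $ j) \<and>
         (\<forall>i \<in> I. vec_mult_mat y M $ i = a $ i)} = 1" by simp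
qed

text \<open>This removes probability from the problem: what remains to be carried over to a smaller
  matrix is invertibility and the block condition.\<close>

lemma linear_aont_iff_block_injective:
  fixes M :: "'a :: {finite, field} mat"
  shows "linear_aont t s M \<longleftrightarrow>
    1 \<le> t \<and> t \<le> s \<and> M \<in> carrier_mat s s \<and> invertible_mat M \<and>
    (\<forall>I J. I \<subseteq> {..<s} \<and> card I = t \<and> J \<subseteq> {..<s} \<and> card J = t \<longrightarrow> block_injective M s I J)"
  unfolding linear_aont_def aont_def
  using no_information_iff_block_injective[of M s _ t] bij_betw_inv_into[OF bij_vec_mult_mat[of M s]]
  by blast

section \<open>Deleting a row and a column\<close>

lemma invertible_mat_iff_det:
  fixes A :: "'a :: field mat"
  assumes A: "A \<in> carrier_mat n n"
  shows "invertible_mat A \<longleftrightarrow> Determinant.det A \<noteq> 0"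
proof
  assume "invertible_mat A"
  then obtain B where B: "A * B = 1\<^sub>m n" "B * A = 1\<^sub>m (dim_row B)"
    using A unfolding invertible_mat_def inverts_mat_def by auto
  have dB: "B \<in> carrier_mat n n"
    using arg_cong[OF B(1), of dim_col] arg_cong[OF B(2), of dim_col] A by auto
  show "Determinant.det A \<noteq> 0" using det_mult[OF A dB] B(1) by auto
next
  assume "Determinant.det A \<noteq> 0"
  then have "A \<in> Units (ring_mat TYPE('a) n ())" by (rule det_non_zero_imp_unit[OF A])
  then obtain B where "B \<in> carrier_mat n n" "A * B = 1\<^sub>m n" "B * A = 1\<^sub>m n"
    unfolding Units_def ring_mat_def by auto
  then show "invertible_mat A"
    using A unfolding invertible_mat_def inverts_mat_def by auto
qed

text \<open>Expand the nonzero determinant along column c: some cofactor in that column is nonzero,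
  and up to sign it is the determinant of the matrix with row r and column c deleted.\<close>

lemma invertible_mat_delete:
  fixes A :: "'a :: field mat"
  assumes A: "A \<in> carrier_mat n n" and inv: "invertible_mat A" and c: "c < n"
  obtains r where "r < n" "invertible_mat (mat_delete A r c)"
proof -
  have "(\<Sum>i<n. A $$ (i, c) * cofactor A i c) \<noteq> 0"
    using laplace_expansion_column[OF A c] inv invertible_mat_iff_det[OF A] by simp
  then obtain r where r: "r < n" "cofactor A r c \<noteq> 0"
    by (metis (no_types, lifting) lessThan_iff mult_zero_right sum.neutral)
  then have "Determinant.det (mat_delete A r c) \<noteq> 0" unfolding cofactor_def by auto
  with r(1) show ?thesis
    using that invertible_mat_iff_det[OF mat_delete_carrier[OF A]] by blast
qed

lemma insert_index_less_Suc: "k < n \<Longrightarrow> insert_index r k < Suc n"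
  unfolding insert_index_def by auto

text \<open>A submatrix of the smaller matrix is a submatrix of M once its indices are shifted past
  r and c by \<open>insert_index\<close>. In terms of vectors, a kernel vector y extends by a zero
  to a kernel vector of M.\<close>

lemma block_injective_mat_delete:
  fixes M :: "'a :: comm_ring_1 mat"
  assumes M: "M \<in> carrier_mat (Suc n) (Suc n)" and r: "r < Suc n" and c: "c < Suc n"
    and I: "I \<subseteq> {..<n}"
    and ker: "block_injective M (Suc n) (insert_index c ` I) (insert_index r ` J)"
  shows "block_injective (mat_delete M r c) n I J"
  unfolding block_injective_def
proof (intro ballI impI)
  fix y assume y: "y \<in> carrier_vec n"
    and yJ: "(\<forall>j \<in> {..<n} - J. y $ j = 0) \<and> (\<forall>i \<in> I. vec_mult_mat y (mat_delete M r c) $ i = 0)"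
  \<comment> \<open>This is y with a 0 inserted at position r, so the deleted row of M contributes
    nothing to u M.\<close>
  define u where "u = vec (Suc n) (\<lambda>j. if j = r then 0 else y $ delete_index r j)"
  have D: "mat_delete M r c \<in> carrier_mat n n" using mat_delete_carrier[OF M] by simp
  have u: "u \<in> carrier_vec (Suc n)" by (simp add: u_def)
  have ur: "u $ r = 0" using r by (simp add: u_def)
  have ui: "u $ insert_index r k = y $ k" if "k < n" for k
    using insert_index_less_Suc[OF that] by (simp add: u_def)
  have range: "{..<Suc n} = insert r (insert_index r ` {..<n})"
    using insert_index_image[OF r] r by (auto simp: lessThan_atLeast0)
  have "u $ j = 0" if "j \<in> {..<Suc n} - insert_index r ` J" for j
    using that yJ ui ur unfolding range by auto
  moreover have "vec_mult_mat u M $ insert_index c i = 0" if i: "i \<in> I" for i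
  proof -
    have i': "i < n" using i I by auto
    have "vec_mult_mat u M $ insert_index c i = (\<Sum>j<Suc n. M $$ (j, insert_index c i) * u $ j)"
      by (rule vec_mult_mat_index[OF M u insert_index_less_Suc[OF i']])
    also have "\<dots> = (\<Sum>j\<in>insert_index r ` {..<n}. M $$ (j, insert_index c i) * u $ j)"
      unfolding range using ur
      by (subst sum.insert) (auto simp: insert_index_exclude[THEN not_sym])
    also have "\<dots> = (\<Sum>k<n. M $$ (insert_index r k, insert_index c i) * y $ k)"
      by (subst sum.reindex[OF insert_index_inj_on]) (simp add: ui)
    also have "\<dots> = (\<Sum>k<n. mat_delete M r c $$ (k, i) * y $ k)"
      using mat_delete_index[OF M r c _ i'] by simp
    also have "\<dots> = vec_mult_mat y (mat_delete M r c) $ i"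
      by (rule vec_mult_mat_index[OF D y i', symmetric])
    finally show ?thesis using yJ i by simp
  qed
  ultimately have u0: "u = 0\<^sub>v (Suc n)" using ker u unfolding block_injective_def by auto
  \<comment> \<open>Every entry of y reappears in u at the shifted index.\<close>
  show "y = 0\<^sub>v n"
  proof (rule eq_vecI)
    fix k assume k: "k < dim_vec (0\<^sub>v n :: 'a vec)"
    then show "y $ k = 0\<^sub>v n $ k"
      using ui[of k] insert_index_less_Suc[of k n r] by (simp add: u0)
  qed (use y in auto)
qed

theorem theorem20:
  fixes q t s :: nat
  assumes "primepow q" and "CARD('a :: {finite, field}) = q"
    and "0 < t" and "t < s"
    and "\<exists>M :: 'a mat. linear_aont t s M"
  shows "\<exists>M :: 'a mat. linear_aont t (s - 1) M"
proof -
  obtain M :: "'a mat" where "linear_aont t s M" using assms(5) by blast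
  moreover obtain n where s: "s = Suc n" using \<open>t < s\<close> by (cases s) auto
  ultimately have M: "M \<in> carrier_mat (Suc n) (Suc n)" "invertible_mat M"
    and ker: "\<And>I J. I \<subseteq> {..<Suc n} \<Longrightarrow> card I = t \<Longrightarrow> J \<subseteq> {..<Suc n} \<Longrightarrow> card J = t \<Longrightarrow>
      block_injective M (Suc n) I J"
    unfolding linear_aont_iff_block_injective by auto
  \<comment> \<open>The column may be chosen freely, here 0; the row is then dictated by a nonzero
    cofactor.\<close>
  obtain r where r: "r < Suc n" and inv: "invertible_mat (mat_delete M r 0)"
    using invertible_mat_delete[OF M] by blast
  \<comment> \<open>The index shifts are injective, so t-sets of indices below n become t-sets below
    \<open>Suc n\<close>, where \<open>ker\<close> applies.\<close>
  have "block_injective (mat_delete M r 0) n I J"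
    if "I \<subseteq> {..<n}" "card I = t" "J \<subseteq> {..<n}" "card J = t" for I J
    using that
    by (intro block_injective_mat_delete[OF M(1) r] ker)
      (auto simp: card_image[OF insert_index_inj_on] simp del: insert_index
        intro: insert_index_less_Suc)
  \<comment> \<open>The bound t \<le> n required of the smaller transform is t < s.\<close>
  then have "linear_aont t n (mat_delete M r 0)"
    unfolding linear_aont_iff_block_injective
    using assms(3,4) s inv mat_delete_carrier[OF M(1)] by auto
  then show ?thesis using s by auto
qed

end
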